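(* The tableau calculus for HdPL is sound for the class of d-product frames: for every formula $\varphi$, if $\vdash \varphi$ (in the HdPL tableau calculus), then $\models \varphi$ (that is, $\varphi$ holds at every point of every d-product model).
   Context: **Language.** Fix a countable set $\mathbf{Prop}$ of propositional variables and two disjoint countably infinite sets $\mathbf{Nom}_1$, $\mathbf{Nom}_2$ of nominals, disjoint from $\mathbf{Prop}$; $\mathbf{Nom}=\mathbf{Nom}_1\cup\mathbf{Nom}_2$. Letters $i,j,k$ range over $\mathbf{Nom}_1$ and $a,b,c$ over $\mathbf{Nom}_2$. Formulas: $\varphi ::= p \mid i \mid a \mid \neg\varphi \mid \varphi\land\varphi \mid \diamondsuit_1\varphi \mid \diamondsuit_2\varphi \mid @_i\varphi \mid @_a\varphi$ with $p\in\mathbf{Prop}$. **Semantics.** Given a Kripke frame $(W_1,R_1)$ ($W_1$ non-empty countable, $R_1\subseteq W_1\times W_1$) and a multi-modal Kripke frame $(W_2,(R_2(x))_{x\in W_1})$ ($W_2$ non-empty countable, each $R_2(x)\subseteq W_2\times W_2$), the dependent product frame (d-product frame) is $(W,R_h,R_v)$ with $W=W_1\times W_2$; $(x,y)R_h(x',y')$ iff $xR_1x'$ and $y=y'$; $(x,y)R_v(x',y')$ iff $x=x'$ and $yR_2(x)y'$. A d-product model $\mathfrak M=(\mathfrak F,V)$ is a d-product frame with $V:\mathbf{Prop}\cup\mathbf{Nom}\to\mathcal P(W)$ such that $V(i)=\{x\}\times W_2$ for some $x\in W_1$ (denoted $i^V$) and $V(a)=W_1\times\{y\}$ for some $y\in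 W_2$ (denoted $a^V$). Satisfaction: $\mathfrak M,(x,y)\models p$ iff $(x,y)\in V(p)$; $\models i$ iff $x=i^V$; $\models a$ iff $y=a^V$; $\neg,\land$ as usual; $\models\diamondsuit_1\varphi$ (resp. $\diamondsuit_2\varphi$) iff $\varphi$ holds at some $R_h$-successor (resp. $R_v$-successor) of $(x,y)$; $\mathfrak M,(x,y)\models @_i\varphi$ iff $\mathfrak M,(i^V,y)\models\varphi$; $\mathfrak M,(x,y)\models @_a\varphi$ iff $\mathfrak M,(x,a^V)\models\varphi$. **HdPL tableau.** A tableau is a well-founded tree (each node is reached from the root in finitely many steps; branches may be infinite) constructed as follows. Start with a root formula of the form $@_i@_a\neg\varphi$, where $i,a$ do not occur in $\varphi$. Extend each branch by applying the rules below to all nodes as often as possible; no formula can be added to a branch any more if every new formula generated by applying an arbitrary rule already exists in the branch, or if the branch is closed. A branch is a maximal path; $\varphi\in\Theta$ means $\varphi$ occurs in the branch $\Theta$. Rules (premises / formulas added; "$\mid$" means the branch splits): - $[\neg\neg]$: $@_i@_a\neg\neg\varphi\ /\ @_i@_a\varphi$. - $[\land]$: $@_i@_a(\varphi\land\psi)\ /\ @_i@_a\varphi,\ @_i@_a\psi$. - $[\neg\land]$: $@_i@_a\neg(\varphi\land\psi)\ /\ @_i@_a\neg\varphi\mid @_i@_a\neg\psi$. - $[\diamondsuit_1]$: $@_i@_a\diamondsuit_1\varphi\ /\ @_i\diamondsuit_1 j,\ @_j@_a\varphi$, where $j\in\mathbf{Nom}_1$ does not occur in the branch; applied only once per formula.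 - $[\diamondsuit_2^d]$: $@_i@_a\diamondsuit_2\varphi\ /\ @_i@_a\diamondsuit_2 b,\ @_i@_b\varphi$, where $b\in\mathbf{Nom}_2$ does not occur in the branch; applied only once per formula. The added formula $@_i@_a\diamondsuit_2 b$, containing the new nominal $b$, is called an accessibility formula. - $[\neg\diamondsuit_1]$: $@_i@_a\neg\diamondsuit_1\varphi,\ @_i\diamondsuit_1 j\ /\ @_j@_a\neg\varphi$. - $[\neg\diamondsuit_2^d]$: $@_i@_a\neg\diamondsuit_2\varphi,\ @_i@_a\diamondsuit_2 b\ /\ @_i@_b\neg\varphi$. - $[@_1]$: $@_i@_a@_j\varphi\ /\ @_j@_a\varphi$. $[@_2]$: $@_i@_a@_b\varphi\ /\ @_i@_b\varphi$. - $[\neg@_1]$: $@_i@_a\neg@_j\varphi\ /\ @_j@_a\neg\varphi$. $[\neg@_2]$: $@_i@_a\neg@_b\varphi\ /\ @_i@_b\neg\varphi$. - $[Red_1]$: $@_i@_as\ /\ @_is$. $[Red_2]$: $@_i@_at\ /\ @_at$. - $[\neg_1]$: $@_i\neg j\ /\ @_jj$. $[\neg_2]$: $@_a\neg b\ /\ @_bb$. - $[Id_1]$: $@_i@_a\varphi,\ @_ij\ /\ @_j@_a\varphi$. $[Id_2]$: $@_i@_a\varphi,\ @_ab\ /\ @_i@_b\varphi$. - $[Id'_1]$: $@_is,\ @_ij\ /\ @_js$. $[Id'_2]$: $@_at,\ @_ab\ /\ @_bt$. In $Red_1,Id'_1$: $s=k$ or $\neg k$ with $k\in\mathbf{Nom}_1$;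 in $Red_2,Id'_2$: $t=c$ or $\neg c$ with $c\in\mathbf{Nom}_2$. Restriction: when applying $[\diamondsuit_2^d]$, $[Id_1]$ or $[Id_2]$, none of the premises may be an accessibility formula. A branch $\Theta$ is closed if for some $\varphi,i,a$: $@_i@_a\varphi,@_i@_a\neg\varphi\in\Theta$, or $@_i\varphi,@_i\neg\varphi\in\Theta$, or $@_a\varphi,@_a\neg\varphi\in\Theta$; otherwise open. A tableau is closed if all its branches are closed. $\vdash\varphi$ iff there is a closed HdPL tableau whose root formula is $@_i@_a\neg\varphi$, with $i\in\mathbf{Nom}_1$, $a\in\mathbf{Nom}_2$ not occurring in $\varphi$. *)

theory Defs
  imports Main "HOL-Library.Countable_Set" "HOL-Library.Extended_Nat"
    "HOL-Library.Infinite_Typeclass"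
begin

datatype (props: 'p, noms1: 'i, noms2: 'a) form =
    Pro 'p
  | Nom1 'i
  | Nom2 'a
  | Neg "('p, 'i, 'a) form"
  | Con "('p, 'i, 'a) form" "('p, 'i, 'a) form"
  | Dia1 "('p, 'i, 'a) form"
  | Dia2 "('p, 'i, 'a) form"
  | At1 'i "('p, 'i, 'a) form"
  | At2 'a "('p, 'i, 'a) form"

abbreviation At :: "'i \<Rightarrow> 'a \<Rightarrow> ('p, 'i, 'a) form \<Rightarrow> ('p, 'i, 'a) form" where
  "At i a \<phi> \<equiv> At1 i (At2 a \<phi>)"

text \<open>The valuation is split into its restrictions to propositional variables and to the two
  sorts of nominals.\<close>

record ('p, 'i, 'a, 'w, 'v) model =
  W1 :: "'w set"
  W2 :: "'v set"
  R1 :: "('w \<times> 'w) set"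
  R2 :: "'w \<Rightarrow> ('v \<times> 'v) set"
  VP :: "'p \<Rightarrow> ('w \<times> 'v) set"
  V1 :: "'i \<Rightarrow> ('w \<times> 'v) set"
  V2 :: "'a \<Rightarrow> ('w \<times> 'v) set"

definition worlds :: "('p, 'i, 'a, 'w, 'v) model \<Rightarrow> ('w \<times> 'v) set" where
  "worlds M = W1 M \<times> W2 M"

definition Rh :: "('p, 'i, 'a, 'w, 'v) model \<Rightarrow> (('w \<times> 'v) \<times> ('w \<times> 'v)) set" where
  "Rh M = {((x, y), (x', y')). (x, y) \<in> worlds M \<and> (x', y') \<in> worlds M \<and>
             (x, x') \<in> R1 M \<and> y = y'}"

definition Rv :: "('p, 'i, 'a, 'w, 'v) model \<Rightarrow> (('w \<times> 'v) \<times> ('w \<times> 'v)) set" where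
  "Rv M = {((x, y), (x', y')). (x, y) \<in> worlds M \<and> (x', y') \<in> worlds M \<and>
             x = x' \<and> (y, y') \<in> R2 M x}"

definition d_product_model :: "('p, 'i, 'a, 'w, 'v) model \<Rightarrow> bool" where
  "d_product_model M \<longleftrightarrow>
     W1 M \<noteq> {} \<and> countable (W1 M) \<and> R1 M \<subseteq> W1 M \<times> W1 M \<and>
     W2 M \<noteq> {} \<and> countable (W2 M) \<and> (\<forall>x\<in>W1 M. R2 M x \<subseteq> W2 M \<times> W2 M) \<and>
     (\<forall>p. VP M p \<subseteq> worlds M) \<and>
     (\<forall>i. \<exists>x\<in>W1 M. V1 M i = {x} \<times> W2 M) \<and>
     (\<forall>a. \<exists>y\<in>W2 M. V2 M a = W1 M \<times> {y})"

definition den1 :: "('p, 'i, 'a, 'w, 'v) model \<Rightarrow> 'i \<Rightarrow> 'w" where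
  "den1 M i = (THE x. x \<in> W1 M \<and> V1 M i = {x} \<times> W2 M)"

definition den2 :: "('p, 'i, 'a, 'w, 'v) model \<Rightarrow> 'a \<Rightarrow> 'v" where
  "den2 M a = (THE y. y \<in> W2 M \<and> V2 M a = W1 M \<times> {y})"

primrec sat :: "('p, 'i, 'a, 'w, 'v) model \<Rightarrow> 'w \<times> 'v \<Rightarrow> ('p, 'i, 'a) form \<Rightarrow> bool" where
  "sat M w (Pro p) \<longleftrightarrow> w \<in> VP M p"
| "sat M w (Nom1 i) \<longleftrightarrow> fst w = den1 M i"
| "sat M w (Nom2 a) \<longleftrightarrow> snd w = den2 M a"
| "sat M w (Neg \<phi>) \<longleftrightarrow> \<not> sat M w \<phi>"
| "sat M w (Con \<phi> \<psi>) \<longleftrightarrow> sat M w \<phi> \<and> sat M w \<psi>"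
| "sat M w (Dia1 \<phi>) \<longleftrightarrow> (\<exists>w'. (w, w') \<in> Rh M \<and> sat M w' \<phi>)"
| "sat M w (Dia2 \<phi>) \<longleftrightarrow> (\<exists>w'. (w, w') \<in> Rv M \<and> sat M w' \<phi>)"
| "sat M w (At1 i \<phi>) \<longleftrightarrow> sat M (den1 M i, snd w) \<phi>"
| "sat M w (At2 a \<phi>) \<longleftrightarrow> sat M (fst w, den2 M a) \<phi>"

text \<open>A tree node holds the formulas added by one rule application (for the root, the root
  formula).  Its origin records whether these formulas come from applying a diamond rule, and to
  which premise; this is what the restrictions ``once per formula'' and ``no accessibility formula
  as premise'' refer to.\<close>

datatype ('p, 'i, 'a) origin =
    Plain
  | ByDia1 "('p, 'i, 'a) form"
  | ByDia2 "('p, 'i, 'a) form"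

type_synonym ('p, 'i, 'a) node = "('p, 'i, 'a) origin \<times> ('p, 'i, 'a) form list"

definition forms :: "('p, 'i, 'a) node set \<Rightarrow> ('p, 'i, 'a) form set" where
  "forms B = (\<Union>n\<in>B. set (snd n))"

text \<open>The accessibility formula is the first of the two formulas added by the rule for the second
  diamond.\<close>

definition access :: "('p, 'i, 'a) node set \<Rightarrow> ('p, 'i, 'a) form set" where
  "access B = {\<psi>. \<exists>\<phi> \<psi>s. (ByDia2 \<phi>, \<psi> # \<psi>s) \<in> B}"

inductive lit1 :: "('p, 'i, 'a) form \<Rightarrow> bool" where
  "lit1 (Nom1 k)"
| "lit1 (Neg (Nom1 k))"

inductive lit2 :: "('p, 'i, 'a) form \<Rightarrow> bool" where
  "lit2 (Nom2 c)"
| "lit2 (Neg (Nom2 c))"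

text \<open>\<open>rule_app B ns\<close>: some rule is applicable to the (initial segment of a) branch with node
  labels \<open>B\<close>, and \<open>ns\<close> are the labels of the nodes it produces, one for each branch into which it
  splits.\<close>

inductive rule_app :: "('p, 'i, 'a) node set \<Rightarrow> ('p, 'i, 'a) node list \<Rightarrow> bool"
  for B :: "('p, 'i, 'a) node set" where
  NegNeg: "At i a (Neg (Neg \<phi>)) \<in> forms B \<Longrightarrow> rule_app B [(Plain, [At i a \<phi>])]"
| Con: "At i a (Con \<phi> \<psi>) \<in> forms B \<Longrightarrow> rule_app B [(Plain, [At i a \<phi>, At i a \<psi>])]"
| NegCon: "At i a (Neg (Con \<phi> \<psi>)) \<in> forms B \<Longrightarrow>
    rule_app B [(Plain, [At i a (Neg \<phi>)]), (Plain, [At i a (Neg \<psi>)])]"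
| Dia1: "At i a (Dia1 \<phi>) \<in> forms B \<Longrightarrow>
    ByDia1 (At i a (Dia1 \<phi>)) \<notin> fst ` B \<Longrightarrow>
    j \<notin> (\<Union>\<psi>\<in>forms B. noms1 \<psi>) \<Longrightarrow>
    rule_app B [(ByDia1 (At i a (Dia1 \<phi>)), [At1 i (Dia1 (Nom1 j)), At j a \<phi>])]"
| Dia2: "At i a (Dia2 \<phi>) \<in> forms B \<Longrightarrow>
    At i a (Dia2 \<phi>) \<notin> access B \<Longrightarrow>
    ByDia2 (At i a (Dia2 \<phi>)) \<notin> fst ` B \<Longrightarrow>
    b \<notin> (\<Union>\<psi>\<in>forms B. noms2 \<psi>) \<Longrightarrow>
    rule_app B [(ByDia2 (At i a (Dia2 \<phi>)), [At i a (Dia2 (Nom2 b)), At i b \<phi>])]"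
| NegDia1: "At i a (Neg (Dia1 \<phi>)) \<in> forms B \<Longrightarrow> At1 i (Dia1 (Nom1 j)) \<in> forms B \<Longrightarrow>
    rule_app B [(Plain, [At j a (Neg \<phi>)])]"
| NegDia2: "At i a (Neg (Dia2 \<phi>)) \<in> forms B \<Longrightarrow> At i a (Dia2 (Nom2 b)) \<in> forms B \<Longrightarrow>
    rule_app B [(Plain, [At i b (Neg \<phi>)])]"
| At1: "At i a (At1 j \<phi>) \<in> forms B \<Longrightarrow> rule_app B [(Plain, [At j a \<phi>])]"
| At2: "At i a (At2 b \<phi>) \<in> forms B \<Longrightarrow> rule_app B [(Plain, [At i b \<phi>])]"
| NegAt1: "At i a (Neg (At1 j \<phi>)) \<in> forms B \<Longrightarrow> rule_app B [(Plain, [At j a (Neg \<phi>)])]"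
| NegAt2: "At i a (Neg (At2 b \<phi>)) \<in> forms B \<Longrightarrow> rule_app B [(Plain, [At i b (Neg \<phi>)])]"
| Red1: "At i a s \<in> forms B \<Longrightarrow> lit1 s \<Longrightarrow> rule_app B [(Plain, [At1 i s])]"
| Red2: "At i a t \<in> forms B \<Longrightarrow> lit2 t \<Longrightarrow> rule_app B [(Plain, [At2 a t])]"
| Neg1: "At1 i (Neg (Nom1 j)) \<in> forms B \<Longrightarrow> rule_app B [(Plain, [At1 j (Nom1 j)])]"
| Neg2: "At2 a (Neg (Nom2 b)) \<in> forms B \<Longrightarrow> rule_app B [(Plain, [At2 b (Nom2 b)])]"
| Id1: "At i a \<phi> \<in> forms B \<Longrightarrow> At i a \<phi> \<notin> access B \<Longrightarrow> At1 i (Nom1 j) \<in> forms B \<Longrightarrow>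
    rule_app B [(Plain, [At j a \<phi>])]"
| Id2: "At i a \<phi> \<in> forms B \<Longrightarrow> At i a \<phi> \<notin> access B \<Longrightarrow> At2 a (Nom2 b) \<in> forms B \<Longrightarrow>
    rule_app B [(Plain, [At i b \<phi>])]"
| Id1': "At1 i s \<in> forms B \<Longrightarrow> lit1 s \<Longrightarrow> At1 i (Nom1 j) \<in> forms B \<Longrightarrow>
    rule_app B [(Plain, [At1 j s])]"
| Id2': "At2 a t \<in> forms B \<Longrightarrow> lit2 t \<Longrightarrow> At2 a (Nom2 b) \<in> forms B \<Longrightarrow>
    rule_app B [(Plain, [At2 b t])]"

definition closed_branch :: "('p, 'i, 'a) node set \<Rightarrow> bool" where
  "closed_branch B \<longleftrightarrow>
     (\<exists>\<phi> i a. At i a \<phi> \<in> forms B \<and> At i a (Neg \<phi>) \<in> forms B) \<or>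
     (\<exists>\<phi> i. At1 i \<phi> \<in> forms B \<and> At1 i (Neg \<phi>) \<in> forms B) \<or>
     (\<exists>\<phi> a. At2 a \<phi> \<in> forms B \<and> At2 a (Neg \<phi>) \<in> forms B)"

text \<open>A rule application needs no (further) carrying out on \<open>B\<close> if for one of its alternatives all
  formulas are present already, or if it is a diamond rule that has been applied to the same
  premise, possibly with a different new nominal.\<close>

definition fulfilled :: "('p, 'i, 'a) node set \<Rightarrow> ('p, 'i, 'a) node list \<Rightarrow> bool" where
  "fulfilled B ns \<longleftrightarrow>
     (\<exists>n\<in>set ns. set (snd n) \<subseteq> forms B \<or> fst n \<noteq> Plain \<and> fst n \<in> fst ` B)"

definition saturated :: "('p, 'i, 'a) node set \<Rightarrow> bool" where
  "saturated B \<longleftrightarrow> (\<forall>ns. rule_app B ns \<longrightarrow> fulfilled B ns)"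

text \<open>Each node is finitely many steps away from the root, but branches may be infinite.\<close>

codatatype 'n tree = Tree (label: 'n) (subtrees: "'n tree list")

text \<open>A path is given by the subtrees at its nodes; \<open>l\<close> is its number of edges.\<close>

definition path :: "'n tree \<Rightarrow> enat \<Rightarrow> (nat \<Rightarrow> 'n tree) \<Rightarrow> bool" where
  "path T l \<pi> \<longleftrightarrow> \<pi> 0 = T \<and> (\<forall>k. enat k < l \<longrightarrow> \<pi> (Suc k) \<in> set (subtrees (\<pi> k)))"

definition branch :: "'n tree \<Rightarrow> enat \<Rightarrow> (nat \<Rightarrow> 'n tree) \<Rightarrow> bool" where
  "branch T l \<pi> \<longleftrightarrow> path T l \<pi> \<and> (\<forall>k. l = enat k \<longrightarrow> subtrees (\<pi> k) = [])"

definition nodes :: "(nat \<Rightarrow> 'n tree) \<Rightarrow> enat \<Rightarrow> 'n set" where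
  "nodes \<pi> l = {label (\<pi> k) | k. enat k \<le> l}"

text \<open>The last conjunct says that rules are applied as often as possible also along infinite
  branches: on an open branch, no rule application that was available at some stage is
  neglected.\<close>

definition tableau :: "('p, 'i, 'a) form \<Rightarrow> ('p, 'i, 'a) node tree \<Rightarrow> bool" where
  "tableau \<rho> T \<longleftrightarrow>
     label T = (Plain, [\<rho>]) \<and>
     (\<forall>\<pi> k. path T (enat k) \<pi> \<longrightarrow>
        (if closed_branch (nodes \<pi> (enat k)) \<or> saturated (nodes \<pi> (enat k))
         then subtrees (\<pi> k) = []
         else rule_app (nodes \<pi> (enat k)) (map label (subtrees (\<pi> k))))) \<and>
     (\<forall>\<pi> l. branch T l \<pi> \<and> \<not> closed_branch (nodes \<pi> l) \<longrightarrow>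
        (\<forall>k ns. enat k \<le> l \<and> rule_app (nodes \<pi> (enat k)) ns \<longrightarrow> fulfilled (nodes \<pi> l) ns))"

definition closed_tableau :: "('p, 'i, 'a) node tree \<Rightarrow> bool" where
  "closed_tableau T \<longleftrightarrow> (\<forall>\<pi> l. branch T l \<pi> \<longrightarrow> closed_branch (nodes \<pi> l))"

definition provable :: "('p, 'i, 'a) form \<Rightarrow> bool" where
  "provable \<phi> \<longleftrightarrow>
     (\<exists>i a T. i \<notin> noms1 \<phi> \<and> a \<notin> noms2 \<phi> \<and>
        tableau (At i a (Neg \<phi>)) T \<and> closed_tableau T)"

end

theory Submission
  imports Defs
begin

text \<open>
  Suppose \<open>\<phi>\<close> fails at a point of a d-product model \<open>M\<close>.  Since \<open>i\<close> and \<open>a\<close> do not occur in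
  \<open>\<phi>\<close>, they can be made to name the coordinates of that point, so that the root formula becomes
  true.  Call a set of nodes realizable over \<open>M\<close> if all its formulas are true everywhere after
  some reinterpretation of the nominals; frame and propositional valuation stay those of \<open>M\<close>.
  Realizability passes from a set of nodes to one of the alternatives of each rule that applies
  to it (lemma \<open>rule_app_sound\<close>).  Only the diamond rules require a change of the model: their
  new nominal is made to name a coordinate of the witnessing successor.

  Starting from the root one can therefore walk down any tableau through realizable initial
  segments, and a realizable set of nodes is not closed.  The walk either ends in a leaf, which
  gives an open finite branch, or goes on forever.  In the latter case no single model need verify
  the whole branch, as the interpretation of the nominals is revised along the way.  This does not
  matter: two formulas suffice to close a branch, so a closed infinite branch would already
  have a closed finite initial segment (lemma \<open>closed_branch_finitary\<close>).  In either case the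
  tableau is not closed.

  Truth \<^emph>\<open>everywhere\<close>, rather than at a chosen point, is the right invariant because the
  formulas on a branch denote facts that do not depend on the point of evaluation: the prefix
  \<open>@\<^sub>i@\<^sub>a\<close> fixes both coordinates, and a formula with a one-sided prefix only speaks about the
  coordinate that its prefix fixes.
\<close>

section \<open>Reinterpreting nominals\<close>

lemma den1_eqI:
  assumes "x \<in> W1 M" "V1 M i = {x} \<times> W2 M" "W2 M \<noteq> {}"
  shows "den1 M i = x"
  unfolding den1_def by (rule the_equality) (use assms in auto)

lemma den2_eqI:
  assumes "y \<in> W2 M" "V2 M a = W1 M \<times> {y}" "W1 M \<noteq> {}"
  shows "den2 M a = y"
  unfolding den2_def by (rule the_equality) (use assms in auto)

lemma obtain_world:
  assumes "d_product_model M"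
  obtains w where "w \<in> worlds M"
  using assms unfolding d_product_model_def worlds_def by fastforce

lemma den1_in_W1:
  assumes "d_product_model M"
  shows "den1 M i \<in> W1 M"
proof -
  obtain x where "x \<in> W1 M" "V1 M i = {x} \<times> W2 M"
    using assms unfolding d_product_model_def by blast
  moreover have "W2 M \<noteq> {}"
    using assms unfolding d_product_model_def by blast
  ultimately show ?thesis
    using den1_eqI by metis
qed

lemma den2_in_W2:
  assumes "d_product_model M"
  shows "den2 M a \<in> W2 M"
proof -
  obtain y where "y \<in> W2 M" "V2 M a = W1 M \<times> {y}"
    using assms unfolding d_product_model_def by blast
  moreover have "W1 M \<noteq> {}"
    using assms unfolding d_product_model_def by blast
  ultimately show ?thesis
    using den2_eqI by metis
qed

definition rename1 :: "'i \<Rightarrow> 'w \<Rightarrow> ('p, 'i, 'a, 'w, 'v) model \<Rightarrow> ('p, 'i, 'a, 'w, 'v) model" where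
  "rename1 j x M = M\<lparr>V1 := (V1 M)(j := {x} \<times> W2 M)\<rparr>"

definition rename2 :: "'a \<Rightarrow> 'v \<Rightarrow> ('p, 'i, 'a, 'w, 'v) model \<Rightarrow> ('p, 'i, 'a, 'w, 'v) model" where
  "rename2 b y M = M\<lparr>V2 := (V2 M)(b := W1 M \<times> {y})\<rparr>"

lemma rename_frame [simp]:
  "W1 (rename1 j x M) = W1 M" "W1 (rename2 b y M) = W1 M"
  "W2 (rename1 j x M) = W2 M" "W2 (rename2 b y M) = W2 M"
  "R1 (rename1 j x M) = R1 M" "R1 (rename2 b y M) = R1 M"
  "R2 (rename1 j x M) = R2 M" "R2 (rename2 b y M) = R2 M"
  "worlds (rename1 j x M) = worlds M" "worlds (rename2 b y M) = worlds M"
  "Rh (rename1 j x M) = Rh M" "Rh (rename2 b y M) = Rh M"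
  "Rv (rename1 j x M) = Rv M" "Rv (rename2 b y M) = Rv M"
  "VP (rename1 j x M) = VP M" "VP (rename2 b y M) = VP M"
  by (simp_all add: rename1_def rename2_def worlds_def Rh_def Rv_def)

lemma den_rename_other [simp]:
  "den2 (rename1 j x M) a = den2 M a" "den1 (rename2 b y M) i = den1 M i"
  "i \<noteq> j \<Longrightarrow> den1 (rename1 j x M) i = den1 M i"
  "a \<noteq> b \<Longrightarrow> den2 (rename2 b y M) a = den2 M a"
  by (simp_all add: rename1_def rename2_def den1_def den2_def)

lemma den1_rename1 [simp]:
  assumes "d_product_model M" "x \<in> W1 M"
  shows "den1 (rename1 j x M) j = x"
  by (rule den1_eqI) (use assms in \<open>auto simp: rename1_def d_product_model_def\<close>)

lemma den2_rename2 [simp]: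
  assumes "d_product_model M" "y \<in> W2 M"
  shows "den2 (rename2 b y M) b = y"
  by (rule den2_eqI) (use assms in \<open>auto simp: rename2_def d_product_model_def\<close>)

lemma d_product_model_rename1:
  assumes "d_product_model M" "x \<in> W1 M"
  shows "d_product_model (rename1 j x M)"
  using assms by (simp add: d_product_model_def rename1_def worlds_def) blast

lemma d_product_model_rename2:
  assumes "d_product_model M" "y \<in> W2 M"
  shows "d_product_model (rename2 b y M)"
  using assms by (simp add: d_product_model_def rename2_def worlds_def) blast

lemma sat_rename1:
  assumes "j \<notin> noms1 \<phi>"
  shows "sat (rename1 j x M) w \<phi> \<longleftrightarrow> sat M w \<phi>"
  using assms by (induction \<phi> arbitrary: w) auto

lemma sat_rename2:
  assumes "b \<notin> noms2 \<phi>"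
  shows "sat (rename2 b y M) w \<phi> \<longleftrightarrow> sat M w \<phi>"
  using assms by (induction \<phi> arbitrary: w) auto

section \<open>Realizable sets of nodes\<close>

definition verifies :: "('p, 'i, 'a, 'w, 'v) model \<Rightarrow> ('p, 'i, 'a) node set \<Rightarrow> bool" where
  "verifies M B \<longleftrightarrow> (\<forall>\<psi>\<in>forms B. \<forall>w\<in>worlds M. sat M w \<psi>)"

definition realizable :: "('p, 'i, 'a, 'w, 'v) model \<Rightarrow> ('p, 'i, 'a) node set \<Rightarrow> bool" where
  "realizable M B \<longleftrightarrow>
     (\<exists>f g. d_product_model (M\<lparr>V1 := f, V2 := g\<rparr>) \<and> verifies (M\<lparr>V1 := f, V2 := g\<rparr>) B)"

lemma forms_insert [simp]: "forms (insert n B) = set (snd n) \<union> forms B"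
  by (simp add: forms_def)

lemma verifies_insert:
  "verifies M (insert n B) \<longleftrightarrow> (\<forall>\<psi>\<in>set (snd n). \<forall>w\<in>worlds M. sat M w \<psi>) \<and> verifies M B"
  by (auto simp: verifies_def)

lemma verifiesD: "verifies M B \<Longrightarrow> \<psi> \<in> forms B \<Longrightarrow> w \<in> worlds M \<Longrightarrow> sat M w \<psi>"
  by (simp add: verifies_def)

lemma verifies_rename1:
  assumes "verifies M B" "j \<notin> (\<Union>\<psi>\<in>forms B. noms1 \<psi>)"
  shows "verifies (rename1 j x M) B"
  using assms by (simp add: verifies_def sat_rename1)

lemma verifies_rename2:
  assumes "verifies M B" "b \<notin> (\<Union>\<psi>\<in>forms B. noms2 \<psi>)"
  shows "verifies (rename2 b y M) B"
  using assms by (simp add: verifies_def sat_rename2)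

lemma realizableI:
  assumes "d_product_model M" "verifies M B"
  shows "realizable M B"
  unfolding realizable_def by (rule exI[of _ "V1 M"], rule exI[of _ "V2 M"]) (use assms in simp)

lemma realizable_update [simp]: "realizable (M\<lparr>V1 := f, V2 := g\<rparr>) B \<longleftrightarrow> realizable M B"
  by (simp add: realizable_def)

lemma realizable_rename [simp]:
  "realizable (rename1 j x M) B \<longleftrightarrow> realizable M B"
  "realizable (rename2 b y M) B \<longleftrightarrow> realizable M B"
  by (simp_all add: realizable_def rename1_def rename2_def)

text \<open>The non-emptiness of the frame enters here: truth everywhere of a formula and its negation
  is contradictory only if there is a point at which to evaluate them.\<close>

lemma realizable_not_closed:
  fixes M :: "('p, 'i, 'a, 'w, 'v) model"
  assumes "realizable M B"
  shows "\<not> closed_branch B"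
proof
  assume closed: "closed_branch B"
  obtain N :: "('p, 'i, 'a, 'w, 'v) model" where N: "d_product_model N" "verifies N B"
    using assms unfolding realizable_def by blast
  obtain w where "w \<in> worlds N"
    using obtain_world[OF N(1)] .
  then have sat: "\<And>\<psi>. \<psi> \<in> forms B \<Longrightarrow> sat N w \<psi>"
    using N(2) by (rule verifiesD[rotated 2])
  show False
    using closed unfolding closed_branch_def by (auto dest!: sat)
qed

section \<open>Soundness of the rules\<close>

text \<open>The diamond formula provides a successor, and the new nominal is made to name its first
  coordinate.  Formulas already present, among them the premise, do not mention the new nominal,
  so they stay true.\<close>

lemma Dia1_sound:
  assumes M: "d_product_model M" "verifies M B"
    and prem: "At i a (Dia1 \<phi>) \<in> forms B"
    and fresh: "j \<notin> (\<Union>\<psi>\<in>forms B. noms1 \<psi>)"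
  shows "realizable M (insert (l, [At1 i (Dia1 (Nom1 j)), At j a \<phi>]) B)"
proof -
  obtain w where "w \<in> worlds M"
    using obtain_world[OF M(1)] .
  from verifiesD[OF M(2) prem this] obtain x where
    x: "x \<in> W1 M" "(den1 M i, x) \<in> R1 M" "sat M (x, den2 M a) \<phi>"
    by (auto simp: Rh_def worlds_def)
  let ?N = "rename1 j x M"
  have "i \<noteq> j" "j \<notin> noms1 \<phi>"
    using prem fresh by auto
  then have "verifies ?N (insert (l, [At1 i (Dia1 (Nom1 j)), At j a \<phi>]) B)"
    using M x den1_in_W1[OF M(1)] verifies_rename1[OF M(2) fresh]
    by (auto simp: verifies_insert sat_rename1 Rh_def worlds_def)
  then have "realizable ?N (insert (l, [At1 i (Dia1 (Nom1 j)), At j a \<phi>]) B)"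
    by (rule realizableI[OF d_product_model_rename1[OF M(1) x(1)]])
  then show ?thesis by simp
qed

text \<open>As for the first diamond.  The prefix \<open>@\<^sub>i\<close> of the accessibility formula matters here,
  since vertical accessibility depends on the first coordinate.\<close>

lemma Dia2_sound:
  assumes M: "d_product_model M" "verifies M B"
    and prem: "At i a (Dia2 \<phi>) \<in> forms B"
    and fresh: "b \<notin> (\<Union>\<psi>\<in>forms B. noms2 \<psi>)"
  shows "realizable M (insert (l, [At i a (Dia2 (Nom2 b)), At i b \<phi>]) B)"
proof -
  obtain w where "w \<in> worlds M"
    using obtain_world[OF M(1)] .
  from verifiesD[OF M(2) prem this] obtain y where
    y: "y \<in> W2 M" "(den2 M a, y) \<in> R2 M (den1 M i)" "sat M (den1 M i, y) \<phi>"
    by (auto simp: Rv_def worlds_def)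
  let ?N = "rename2 b y M"
  have "a \<noteq> b" "b \<notin> noms2 \<phi>"
    using prem fresh by auto
  then have "verifies ?N (insert (l, [At i a (Dia2 (Nom2 b)), At i b \<phi>]) B)"
    using M y den1_in_W1[OF M(1)] den2_in_W2[OF M(1)] verifies_rename2[OF M(2) fresh]
    by (auto simp: verifies_insert sat_rename2 Rv_def worlds_def)
  then have "realizable ?N (insert (l, [At i a (Dia2 (Nom2 b)), At i b \<phi>]) B)"
    by (rule realizableI[OF d_product_model_rename2[OF M(1) y(1)]])
  then show ?thesis by simp
qed

lemma rule_app_sound_in_model:
  assumes M: "d_product_model M" "verifies M B"
    and "rule_app B ns"
  shows "\<exists>n\<in>set ns. realizable M (insert n B)"
proof -
  obtain w where w: "w \<in> worlds M"
    using obtain_world[OF M(1)] .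
  have sat: "\<And>\<psi>. \<psi> \<in> forms B \<Longrightarrow> sat M w \<psi>"
    using verifiesD[OF M(2) _ w] .
  note den = den1_in_W1[OF M(1)] den2_in_W2[OF M(1)]
  have keep_in: "\<exists>n\<in>set ns. realizable M (insert n B)"
    if "n \<in> set ns" "\<And>\<psi> v. \<psi> \<in> set (snd n) \<Longrightarrow> v \<in> worlds M \<Longrightarrow> sat M v \<psi>" for n
  proof -
    have "verifies M (insert n B)"
      using that(2) M(2) by (simp add: verifies_insert)
    then show ?thesis
      using that(1) realizableI[OF M(1)] by blast
  qed
  have keep: "\<exists>n\<in>set ns. realizable M (insert n B)"
    if "ns = [(Plain, fs)]" "\<forall>\<psi>\<in>set fs. \<forall>v\<in>worlds M. sat M v \<psi>" for fs
    using that by (intro keep_in[of "(Plain, fs)"]) auto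
  show ?thesis
    using assms(3)
  proof cases
    case (NegCon i a \<phi> \<psi>)
    have "sat M w (At i a (Neg \<phi>)) \<or> sat M w (At i a (Neg \<psi>))"
      using sat[OF NegCon(2)] by auto
    then show ?thesis
    proof
      assume "sat M w (At i a (Neg \<phi>))"
      then show ?thesis
        by (intro keep_in[of "(Plain, [At i a (Neg \<phi>)])"]) (auto simp: NegCon(1))
    next
      assume "sat M w (At i a (Neg \<psi>))"
      then show ?thesis
        by (intro keep_in[of "(Plain, [At i a (Neg \<psi>)])"]) (auto simp: NegCon(1))
    qed
  next
    case (Dia1 i a \<phi> j)
    then show ?thesis using Dia1_sound[OF M] by simp
  next
    case (Dia2 i a \<phi> b)
    then show ?thesis using Dia2_sound[OF M] by simp
  next
    case (NegDia1 i a \<phi> j)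
    \<comment> \<open>The accessibility fact was obtained on the row of \<open>w\<close>; horizontal accessibility is the
      same on every row, so it can be used on the row named by \<open>a\<close>.\<close>
    have "((den1 M i, den2 M a), (den1 M j, den2 M a)) \<in> Rh M"
      using sat[OF NegDia1(3)] den by (auto simp: Rh_def worlds_def)
    then show ?thesis
      using sat[OF NegDia1(2)] by (intro keep[OF NegDia1(1)]) auto
  next
    case (NegDia2 i a \<phi> b)
    have "((den1 M i, den2 M a), (den1 M i, den2 M b)) \<in> Rv M"
      using sat[OF NegDia2(3)] by (auto simp: Rv_def worlds_def)
    then show ?thesis
      using sat[OF NegDia2(2)] by (intro keep[OF NegDia2(1)]) auto
  \<comment> \<open>The other rules have a single alternative, entailed by the premises in the same model.\<close>
  qed (rule keep, assumption, (auto dest!: sat elim!: lit1.cases lit2.cases)[1])+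
qed

lemma rule_app_sound:
  assumes "realizable M B" "rule_app B ns"
  shows "\<exists>n\<in>set ns. realizable M (insert n B)"
proof -
  obtain f g where "d_product_model (M\<lparr>V1 := f, V2 := g\<rparr>)" "verifies (M\<lparr>V1 := f, V2 := g\<rparr>) B"
    using assms(1) unfolding realizable_def by blast
  from rule_app_sound_in_model[OF this assms(2)] show ?thesis by simp
qed

section \<open>Descending along an open branch\<close>

lemma closed_branch_mono:
  assumes "closed_branch B" "B \<subseteq> C"
  shows "closed_branch C"
proof -
  have "forms B \<subseteq> forms C"
    using assms(2) by (auto simp: forms_def)
  then show ?thesis
    using assms(1) unfolding closed_branch_def by blast
qed

lemma closed_branch_finitary:
  assumes "closed_branch B"
  shows "\<exists>m\<in>B. \<exists>n\<in>B. closed_branch {m, n}"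
proof -
  have pair: "\<exists>m\<in>B. \<exists>n\<in>B. \<psi> \<in> forms {m, n} \<and> \<chi> \<in> forms {m, n}"
    if "\<psi> \<in> forms B" "\<chi> \<in> forms B" for \<psi> \<chi>
    using that by (fastforce simp: forms_def)
  from assms consider
    (both) \<phi> i a where "At i a \<phi> \<in> forms B" "At i a (Neg \<phi>) \<in> forms B"
    | (first) \<phi> i where "At1 i \<phi> \<in> forms B" "At1 i (Neg \<phi>) \<in> forms B"
    | (second) \<phi> a where "At2 a \<phi> \<in> forms B" "At2 a (Neg \<phi>) \<in> forms B"
    unfolding closed_branch_def by blast
  then show ?thesis
  proof cases
    case both
    from pair[OF this] show ?thesis
      unfolding closed_branch_def by blast
  next
    case first
    from pair[OF this] show ?thesis
      unfolding closed_branch_def by blast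
  next
    case second
    from pair[OF this] show ?thesis
      unfolding closed_branch_def by blast
  qed
qed

lemma nodes_enat: "nodes \<pi> (enat k) = (\<lambda>m. label (\<pi> m)) ` {..k}"
  by (auto simp: nodes_def)

text \<open>The model is not carried along as part of the state of the descent: what is
  chosen at each stage is only a path whose nodes are realizable, and each chosen path extends the
  previous one, so that the diagonal of the choices is a path again.\<close>

lemma open_branch_exists:
  fixes T :: "('p, 'i, 'a) node tree"
  assumes tab: "tableau \<rho> T"
    and root: "realizable M {(Plain, [\<rho>])}"
  shows "\<exists>\<pi> l. branch T l \<pi> \<and> \<not> closed_branch (nodes \<pi> l)"
proof (rule ccontr)
  assume "\<not> ?thesis"
  then have closed: "\<And>\<pi> l. branch T l \<pi> \<Longrightarrow> closed_branch (nodes \<pi> l)" by blast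
  define P where "P k \<pi> \<longleftrightarrow> path T (enat k) \<pi> \<and> realizable M (nodes \<pi> (enat k))" for k \<pi>
  define Q where "Q k \<pi> \<pi>' \<longleftrightarrow> (\<forall>m\<le>k. \<pi> m = (\<pi>' m :: ('p, 'i, 'a) node tree))" for k :: nat and \<pi> \<pi>'
  have "label T = (Plain, [\<rho>])"
    using tab by (simp add: tableau_def)
  then have "nodes (\<lambda>_. T) (enat 0) = {(Plain, [\<rho>])}"
    by (simp only: nodes_enat) simp
  then have "P 0 (\<lambda>_. T)"
    using root by (simp add: P_def path_def)
  moreover have "\<exists>\<pi>'. P (Suc k) \<pi>' \<and> Q k \<pi> \<pi>'" if "P k \<pi>" for k \<pi>
  proof -
    have \<pi>: "path T (enat k) \<pi>" "realizable M (nodes \<pi> (enat k))"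
      using that by (simp_all add: P_def)
    \<comment> \<open>A leaf would make \<open>\<pi>\<close> a finite branch, closed although its nodes are realizable.\<close>
    have "subtrees (\<pi> k) \<noteq> []"
      using closed[of "enat k" \<pi>] \<pi> realizable_not_closed by (auto simp: branch_def)
    then have "rule_app (nodes \<pi> (enat k)) (map label (subtrees (\<pi> k)))"
      using tab \<pi>(1) unfolding tableau_def by metis
    from rule_app_sound[OF \<pi>(2) this] obtain t where
      t: "t \<in> set (subtrees (\<pi> k))" "realizable M (insert (label t) (nodes \<pi> (enat k)))"
      by auto
    let ?\<pi>' = "\<pi>(Suc k := t)"
    have "nodes ?\<pi>' (enat (Suc k)) = insert (label t) (nodes \<pi> (enat k))"
      by (auto simp: nodes_enat atMost_Suc)
    moreover have "path T (enat (Suc k)) ?\<pi>'"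
      using \<pi>(1) t(1) by (auto simp: path_def less_Suc_eq)
    ultimately have "P (Suc k) ?\<pi>' \<and> Q k \<pi> ?\<pi>'"
      using t(2) by (simp add: P_def Q_def)
    then show ?thesis by blast
  qed
  ultimately obtain \<Pi> where \<Pi>: "\<And>k. P k (\<Pi> k)" "\<And>k. Q k (\<Pi> k) (\<Pi> (Suc k))"
    using dependent_nat_choice[of P Q] by blast
  define \<pi> where "\<pi> k = \<Pi> k k" for k
  have agree: "\<Pi> k m = \<pi> m" if "m \<le> k" for k m
    using that
  proof (induction k rule: dec_induct)
    case base
    then show ?case by (simp add: \<pi>_def)
  next
    case (step k)
    then show ?case using \<Pi>(2)[of k] by (simp add: Q_def)
  qed
  have "path T \<infinity> \<pi>"
    unfolding path_def
  proof (intro conjI allI impI)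
    show "\<pi> 0 = T"
      using \<Pi>(1)[of 0] by (simp add: P_def path_def \<pi>_def)
  next
    fix k
    have "\<Pi> (Suc k) (Suc k) \<in> set (subtrees (\<Pi> (Suc k) k))"
      using \<Pi>(1)[of "Suc k"] by (simp add: P_def path_def)
    then show "\<pi> (Suc k) \<in> set (subtrees (\<pi> k))"
      by (simp add: agree)
  qed
  then have "closed_branch (nodes \<pi> \<infinity>)"
    by (intro closed) (simp add: branch_def)
  from closed_branch_finitary[OF this] obtain m n where
    mn: "closed_branch {label (\<pi> m), label (\<pi> n)}"
    by (auto simp: nodes_def)
  define k where "k = max m n"
  have "realizable M (nodes (\<Pi> k) (enat k))"
    using \<Pi>(1) by (simp add: P_def)
  moreover have "nodes (\<Pi> k) (enat k) = nodes \<pi> (enat k)"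
    by (simp add: nodes_enat agree)
  moreover have "{label (\<pi> m), label (\<pi> n)} \<subseteq> nodes \<pi> (enat k)"
    by (auto simp: nodes_enat k_def)
  ultimately show False
    using mn closed_branch_mono realizable_not_closed by metis
qed

section \<open>Soundness of the calculus\<close>

theorem theorem6p5:
  fixes \<phi> :: "('p::countable, 'i::{countable,infinite}, 'a::{countable,infinite}) form"
    and M :: "('p, 'i, 'a, 'w, 'v) model"
  assumes "provable \<phi>"
    and "d_product_model M"
    and "w \<in> worlds M"
  shows "sat M w \<phi>"
proof (rule ccontr)
  assume false: "\<not> sat M w \<phi>"
  obtain i a T where T: "i \<notin> noms1 \<phi>" "a \<notin> noms2 \<phi>"
    "tableau (At i a (Neg \<phi>)) T" "closed_tableau T"
    using assms(1) unfolding provable_def by blast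
  obtain x y where w: "w = (x, y)" "x \<in> W1 M" "y \<in> W2 M"
    using assms(3) by (auto simp: worlds_def)
  let ?M1 = "rename1 i x M"
  let ?N = "rename2 a y ?M1"
  have M1: "d_product_model ?M1" "y \<in> W2 ?M1"
    using d_product_model_rename1 assms(2) w by (auto simp: rename1_def)
  have "verifies ?N {(Plain, [At i a (Neg \<phi>)])}"
    using false T(1,2) w assms(2) M1
    by (simp add: verifies_def forms_def sat_rename1 sat_rename2)
  then have "realizable ?N {(Plain, [At i a (Neg \<phi>)])}"
    using d_product_model_rename2[OF M1] by (rule realizableI[rotated])
  from open_branch_exists[OF T(3) this] show False
    using T(4) unfolding closed_tableau_def by blast
qed

end
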